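(* Let $\nabla$ be a flat torsion-free connection on a real Lie algebra $\mathfrak g$ and assume that $\psi:(\mathfrak g,\nabla)\to(\mathfrak g^*,\nabla^* )$ is a $\mathfrak g$-module isomorphism. Then the $2$-form $\omega$ on $T_\nabla\mathfrak g$ defined by $$\omega((x,y),(x',y'))=\psi(y)(x')-\psi(y')(x),\qquad x,y,x',y'\in\mathfrak g,$$ is a symplectic structure on $T_\nabla\mathfrak g$ such that $\nabla^1\omega=0$.
   Context: Lie algebras are finite-dimensional over $\mathbb R$. A connection on $\mathfrak g$ is a linear map $\nabla:\mathfrak g\to\mathfrak{gl}(\mathfrak g)$, $x\mapsto\nabla_x$; it is flat if $\nabla_{[x,y]}=[\nabla_x,\nabla_y]$ and torsion-free if $\nabla_xy-\nabla_yx=[x,y]$. For flat $\nabla$, $\nabla^*:\mathfrak g\to\mathfrak{gl}(\mathfrak g^* )$ is the contragredient representation $\nabla^*_x\alpha=-\alpha\circ\nabla_x$. The tangent algebra $T_\nabla\mathfrak g$ is the vector space $\mathfrak g\oplus\mathfrak g$ with bracket $[(x,u),(y,v)]=([x,y],\nabla_xv-\nabla_yu)$, and $\nabla^1$ is the connection on $T_\nabla\mathfrak g$ given by $\nabla^1_{(x,y)}(z,w)=(\nabla_xz,\nabla_xw)$. The form $\omega$ is the one induced via $\psi$ from the form $\Omega((x,\alpha),(y,\beta))=\alpha(y)-\beta(x)$ on $\mathfrak g\oplus_{\nabla^*}\mathfrak g^*$. A symplectic structure on a Lie algebra is a non-degenerate skew-symmetric bilinear form $\omega$ with $\omega(x,[y,z])+\omega(y,[z,x])+\omega(z,[x,y])=0$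 for all $x,y,z$. $\nabla^1\omega=0$ means $\omega(\nabla^1_ua,b)+\omega(a,\nabla^1_ub)=0$ for all $u,a,b$. *)

theory Defs
  imports "HOL-Analysis.Analysis"
begin

typedef (overloaded) ('a::real_vector) dual = "{f :: 'a \<Rightarrow> real. linear f}"
  morphisms dual_apply Abs_dual
  using linear_zero by blast

setup_lifting type_definition_dual

instantiation dual :: (real_vector) real_vector
begin

lift_definition zero_dual :: "'a dual" is "\<lambda>_. 0"
  by (rule linear_zero)

lift_definition plus_dual :: "'a dual \<Rightarrow> 'a dual \<Rightarrow> 'a dual" is "\<lambda>f g x. f x + g x"
  by (rule linear_compose_add)

lift_definition uminus_dual :: "'a dual \<Rightarrow> 'a dual" is "\<lambda>f x. - f x"
  by (rule linear_compose_neg)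

lift_definition minus_dual :: "'a dual \<Rightarrow> 'a dual \<Rightarrow> 'a dual" is "\<lambda>f g x. f x - g x"
  by (rule linear_compose_sub)

lift_definition scaleR_dual :: "real \<Rightarrow> 'a dual \<Rightarrow> 'a dual" is "\<lambda>c f x. c *\<^sub>R f x"
  by (rule linear_compose_scale_right)

instance
  by standard (transfer; simp add: algebra_simps)+

end

lemma linear_dual_apply: "linear (dual_apply f)"
  by transfer

definition finite_dimensional :: "'a::real_vector itself \<Rightarrow> bool" where
  "finite_dimensional _ \<longleftrightarrow> (\<exists>B :: 'a set. finite B \<and> span B = UNIV)"

definition lie_algebra :: "('a::real_vector \<Rightarrow> 'a \<Rightarrow> 'a) \<Rightarrow> bool" where
  "lie_algebra br \<longleftrightarrow>
     finite_dimensional TYPE('a) \<and> bilinear br \<and> (\<forall>x. br x x = 0) \<and>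
     (\<forall>x y z. br x (br y z) + br y (br z x) + br z (br x y) = 0)"

text \<open>A linear map from the Lie algebra to the endomorphisms of a vector space is
  represented in curried form, as a bilinear map; flatness is the condition that it be a
  Lie algebra representation.\<close>

definition flat :: "('a::real_vector \<Rightarrow> 'a \<Rightarrow> 'a) \<Rightarrow> ('a \<Rightarrow> 'v::real_vector \<Rightarrow> 'v) \<Rightarrow> bool" where
  "flat br \<rho> \<longleftrightarrow> (\<forall>x y v. \<rho> (br x y) v = \<rho> x (\<rho> y v) - \<rho> y (\<rho> x v))"

definition representation ::
  "('a::real_vector \<Rightarrow> 'a \<Rightarrow> 'a) \<Rightarrow> ('a \<Rightarrow> 'v::real_vector \<Rightarrow> 'v) \<Rightarrow> bool" where
  "representation br \<rho> \<longleftrightarrow> bilinear \<rho> \<and> flat br \<rho>"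

definition connection :: "('a::real_vector \<Rightarrow> 'a \<Rightarrow> 'a) \<Rightarrow> bool" where
  "connection nabla \<longleftrightarrow> bilinear nabla"

definition torsion_free ::
  "('a::real_vector \<Rightarrow> 'a \<Rightarrow> 'a) \<Rightarrow> ('a \<Rightarrow> 'a \<Rightarrow> 'a) \<Rightarrow> bool" where
  "torsion_free br nabla \<longleftrightarrow> (\<forall>x y. nabla x y - nabla y x = br x y)"

text \<open>The map under \<open>Abs_dual\<close> is linear whenever \<open>\<rho> x\<close> is, so the
  underspecified part of \<open>Abs_dual\<close> plays no role for representations; see
  \<open>dual_apply_contragredient\<close> below.\<close>

definition contragredient ::
  "('a \<Rightarrow> 'v::real_vector \<Rightarrow> 'v) \<Rightarrow> 'a \<Rightarrow> 'v dual \<Rightarrow> 'v dual" where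
  "contragredient \<rho> x \<alpha> = Abs_dual (\<lambda>v. - dual_apply \<alpha> (\<rho> x v))"

lemma dual_apply_contragredient:
  assumes "linear (\<rho> x)"
  shows "dual_apply (contragredient \<rho> x \<alpha>) v = - dual_apply \<alpha> (\<rho> x v)"
proof -
  have "linear (\<lambda>v. - dual_apply \<alpha> (\<rho> x v))"
    using linear_compose_neg[OF linear_compose[OF assms linear_dual_apply[of \<alpha>]]]
    by (simp add: o_def)
  then show ?thesis
    by (simp add: contragredient_def Abs_dual_inverse)
qed

lemma representation_contragredient:
  assumes "representation br \<rho>"
  shows "representation br (contragredient \<rho>)"
proof -
  have l1: "\<And>x. linear (\<rho> x)" and l2: "\<And>v. linear (\<lambda>x. \<rho> x v)"
    and fl: "\<And>x y v. \<rho> (br x y) v = \<rho> x (\<rho> y v) - \<rho> y (\<rho> x v)"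
    using assms by (auto simp: representation_def flat_def bilinear_def)
  note [simp] = dual_apply_contragredient[OF l1]
  note ext = dual_apply_inject[THEN iffD1, OF ext]
  show ?thesis
    unfolding representation_def flat_def bilinear_def
    by (auto intro!: linearI ext
        simp: plus_dual.rep_eq minus_dual.rep_eq scaleR_dual.rep_eq fl
          linear_add[OF l2] linear_scale[OF l2]
          linear_add[OF linear_dual_apply] linear_diff[OF linear_dual_apply]
          linear_scale[OF linear_dual_apply])
qed

definition module_isomorphism ::
  "('a \<Rightarrow> 'v::real_vector \<Rightarrow> 'v) \<Rightarrow> ('a \<Rightarrow> 'w::real_vector \<Rightarrow> 'w) \<Rightarrow> ('v \<Rightarrow> 'w) \<Rightarrow> bool" where
  "module_isomorphism \<rho> \<sigma> \<psi> \<longleftrightarrow>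
     linear \<psi> \<and> bij \<psi> \<and> (\<forall>x v. \<psi> (\<rho> x v) = \<sigma> x (\<psi> v))"

definition symplectic_structure ::
  "('a::real_vector \<Rightarrow> 'a \<Rightarrow> 'a) \<Rightarrow> ('a \<Rightarrow> 'a \<Rightarrow> real) \<Rightarrow> bool" where
  "symplectic_structure br \<omega> \<longleftrightarrow>
     lie_algebra br \<and> bilinear \<omega> \<and>
     (\<forall>x y. \<omega> x y = - \<omega> y x) \<and>
     (\<forall>x. (\<forall>y. \<omega> x y = 0) \<longrightarrow> x = 0) \<and>
     (\<forall>x y z. \<omega> x (br y z) + \<omega> y (br z x) + \<omega> z (br x y) = 0)"

definition parallel_form ::
  "('a::real_vector \<Rightarrow> 'a \<Rightarrow> 'a) \<Rightarrow> ('a \<Rightarrow> 'a \<Rightarrow> real) \<Rightarrow> bool" where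
  "parallel_form nabla \<omega> \<longleftrightarrow> (\<forall>u a b. \<omega> (nabla u a) b + \<omega> a (nabla u b) = 0)"

fun tangent_bracket ::
  "('a::real_vector \<Rightarrow> 'a \<Rightarrow> 'a) \<Rightarrow> ('a \<Rightarrow> 'a \<Rightarrow> 'a) \<Rightarrow> 'a \<times> 'a \<Rightarrow> 'a \<times> 'a \<Rightarrow> 'a \<times> 'a" where
  "tangent_bracket br nabla (x, u) (y, v) = (br x y, nabla x v - nabla y u)"

fun tangent_connection ::
  "('a::real_vector \<Rightarrow> 'a \<Rightarrow> 'a) \<Rightarrow> 'a \<times> 'a \<Rightarrow> 'a \<times> 'a \<Rightarrow> 'a \<times> 'a" where
  "tangent_connection nabla (x, y) (z, w) = (nabla x z, nabla x w)"

fun tangent_form :: "('a::real_vector \<Rightarrow> 'a dual) \<Rightarrow> 'a \<times> 'a \<Rightarrow> 'a \<times> 'a \<Rightarrow> real" where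
  "tangent_form \<psi> (x, y) (x', y') = dual_apply (\<psi> y) x' - dual_apply (\<psi> y') x"

end

theory Submission
  imports Defs
begin

text \<open>Everything is controlled by the pairing \<open>B u x = dual_apply (\<psi> u) x\<close>, in terms of
  which \<open>\<omega> (x, u) (y, v) = B u y - B v x\<close>. Equivariance of \<open>\<psi>\<close> towards the contragredient
  module says exactly that \<open>B\<close> is invariant, \<open>B (nabla x u) y = - B u (nabla x y)\<close>. This
  is already \<open>\<nabla>\<^sup>1\<omega> = 0\<close>, because \<open>\<nabla>\<^sup>1\<close> acts diagonally by \<open>nabla\<close>
  (\<open>tangent_form_parallel\<close>).

  For the cocycle condition, torsion-freeness rewrites the terms \<open>B u [y, z]\<close> coming from
  the base component of the bracket as \<open>B u (nabla y z) - B u (nabla z y)\<close>, while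
  invariance moves \<open>nabla\<close> off the first argument of \<open>B\<close> in the terms coming from the fibre
  component; the six resulting pairs cancel in the cyclic sum
  (\<open>tangent_form_cocycle\<close>).

  The form is non-degenerate because each summand of \<open>T\<^sub>\<nabla>\<gg>\<close> detects the other one:
  injectivity of \<open>\<psi>\<close> handles the fibre, and surjectivity of \<open>\<psi>\<close>, together with the fact
  that linear functionals separate points, handles the base
  (\<open>tangent_form_nondegenerate\<close>). Finally the tangent algebra is the semidirect product of
  the Lie algebra with its module given by \<open>nabla\<close>, whose Jacobi identity combines
  that of \<open>br\<close> with flatness (\<open>lie_algebra_tangent_bracket\<close>).\<close>

lemma finite_dimensional_prod:
  assumes "finite_dimensional TYPE('a::real_vector)" "finite_dimensional TYPE('b::real_vector)"
  shows "finite_dimensional TYPE('a \<times> 'b)"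
proof -
  obtain A :: "'a set" and B :: "'b set"
    where A: "finite A" "span A = UNIV" and B: "finite B" "span B = UNIV"
    using assms by (auto simp: finite_dimensional_def)
  let ?C = "(\<lambda>a. (a, 0)) ` A \<union> (\<lambda>b. (0, b)) ` B"
  have "linear (\<lambda>a::'a. (a, 0::'b))" "linear (\<lambda>b::'b. (0::'a, b))"
    by (auto intro!: linearI)
  then have "span ((\<lambda>a. (a, 0)) ` A) = range (\<lambda>a. (a, 0::'b))"
    and "span ((\<lambda>b. (0, b)) ` B) = range (\<lambda>b. (0::'a, b))"
    using A B by (simp_all add: linear_span_image)
  then have "(a, 0) \<in> span ?C" "(0, b) \<in> span ?C" for a b
    by (metis rangeI span_mono Un_upper1 Un_upper2 subsetD)+
  then have "(a, 0) + (0, b) \<in> span ?C" for a b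
    by (rule span_add)
  then have "span ?C = UNIV"
    by auto
  with A B show ?thesis
    unfolding finite_dimensional_def by (intro exI[of _ ?C]) simp
qed

text \<open>A nonzero vector extends to a basis, and on a basis a functional may be prescribed
  freely.\<close>

lemma dual_separates_points:
  fixes x :: "'a::real_vector"
  assumes "\<And>f :: 'a dual. dual_apply f x = 0"
  shows "x = 0"
proof (rule ccontr)
  assume "x \<noteq> 0"
  then have "independent {x}"
    by simp
  then obtain g :: "'a \<Rightarrow> real" where "linear g" "\<forall>y\<in>{x}. g y = 1"
    using linear_independent_extend[of "{x}" "\<lambda>_. 1::real"] by blast
  then show False
    using assms[of "Abs_dual g"] by (simp add: Abs_dual_inverse)
qed

text \<open>The first component of the Jacobi identity is that of \<open>br\<close>. In the second component
  the terms acting on a fixed fibre vector \<open>u\<close> are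
  \<open>nabla y (nabla z u) - nabla z (nabla y u) - nabla (br y z) u\<close>, so flatness makes them
  vanish.\<close>

lemma lie_algebra_tangent_bracket:
  assumes lie: "lie_algebra br" and "connection nabla" and flat: "flat br nabla"
  shows "lie_algebra (tangent_bracket br nabla)"
proof -
  have br: "bilinear br" "\<And>x. br x x = 0"
    and jac: "\<And>x y z. br x (br y z) + br y (br z x) + br z (br x y) = 0"
    and fd: "finite_dimensional TYPE('a)"
    using lie by (auto simp: lie_algebra_def)
  have nabla: "bilinear nabla"
    using assms by (simp add: connection_def)
  note lin = bilinear_ladd[OF br(1)] bilinear_radd[OF br(1)] bilinear_lmul[OF br(1)]
    bilinear_rmul[OF br(1)] bilinear_ladd[OF nabla] bilinear_radd[OF nabla]
    bilinear_lmul[OF nabla] bilinear_rmul[OF nabla] bilinear_rsub[OF nabla]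
  have fl: "nabla (br x y) v = nabla x (nabla y v) - nabla y (nabla x v)" for x y v
    using flat by (simp add: flat_def)
  have "bilinear (tangent_bracket br nabla)"
    unfolding bilinear_def
    by (auto intro!: linearI simp: lin algebra_simps)
  moreover have "tangent_bracket br nabla X X = 0" for X
    by (cases X) (simp add: br zero_prod_def)
  moreover have "tangent_bracket br nabla X (tangent_bracket br nabla Y Z)
      + tangent_bracket br nabla Y (tangent_bracket br nabla Z X)
      + tangent_bracket br nabla Z (tangent_bracket br nabla X Y) = 0" for X Y Z
    by (cases X; cases Y; cases Z) (simp add: jac lin fl zero_prod_def)
  ultimately show ?thesis
    using finite_dimensional_prod[OF fd fd] by (simp add: lie_algebra_def)
qed

lemma bilinear_dual_apply:
  assumes "linear \<psi>"
  shows "bilinear (\<lambda>u. dual_apply (\<psi> u))"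
  unfolding bilinear_def
  by (auto intro!: linearI simp: linear_add[OF assms] linear_scale[OF assms] plus_dual.rep_eq scaleR_dual.rep_eq
      linear_add[OF linear_dual_apply] linear_scale[OF linear_dual_apply])

text \<open>The sign in the contragredient action turns equivariance of a map into the dual into
  infinitesimal invariance of the pairing that it defines.\<close>

lemma equivariant_pairing_invariant:
  assumes "connection nabla" "module_isomorphism nabla (contragredient nabla) \<psi>"
  shows "dual_apply (\<psi> (nabla x u)) y = - dual_apply (\<psi> u) (nabla x y)"
  using assms
  by (simp add: module_isomorphism_def connection_def bilinear_def dual_apply_contragredient)

lemma bilinear_tangent_form:
  assumes "linear \<psi>"
  shows "bilinear (tangent_form \<psi>)"
proof -
  note B = bilinear_dual_apply[OF assms]
  show ?thesis
    unfolding bilinear_def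
    by (auto intro!: linearI simp: bilinear_ladd[OF B] bilinear_radd[OF B]
        bilinear_lmul[OF B] bilinear_rmul[OF B] algebra_simps)
qed

lemma tangent_form_skew: "tangent_form \<psi> X Y = - tangent_form \<psi> Y X"
  by (cases X; cases Y) simp

text \<open>Testing against \<open>(y, 0)\<close> isolates the functional \<open>\<psi> u\<close>; testing against \<open>(0, v)\<close>
  evaluates at \<open>x\<close> the functional \<open>\<psi> v\<close>, which is arbitrary.\<close>

lemma tangent_form_nondegenerate:
  assumes "linear \<psi>" "bij \<psi>" and 0: "\<And>Y. tangent_form \<psi> X Y = 0"
  shows "X = 0"
proof -
  obtain x u where X: "X = (x, u)"
    by (cases X)
  have [simp]: "\<psi> 0 = 0"
    using \<open>linear \<psi>\<close> by (rule linear_0)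
  have "dual_apply (\<psi> u) y = 0" for y
    using 0[of "(y, 0)"] by (simp add: X zero_dual.rep_eq)
  then have "\<psi> u = \<psi> 0"
    by (intro dual_apply_inject[THEN iffD1] ext) (simp add: zero_dual.rep_eq)
  then have "u = 0"
    using \<open>bij \<psi>\<close> by (meson bij_is_inj injD)
  moreover have "x = 0"
  proof (rule dual_separates_points)
    fix f :: "'a dual"
    obtain v where "f = \<psi> v"
      using \<open>bij \<psi>\<close> by (blast dest: bij_is_surj surjD)
    then show "dual_apply f x = 0"
      using 0[of "(0, v)"] by (simp add: X linear_0[OF linear_dual_apply])
  qed
  ultimately show ?thesis
    by (simp add: X zero_prod_def)
qed

text \<open>For \<open>X = (x, u)\<close>, \<open>Y = (y, v)\<close>, \<open>Z = (z, w)\<close> the first summand contributes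
  \<open>B u (nabla y z) - B u (nabla z y)\<close> from the base. The terms in \<open>u\<close> from the fibre
  come from the other two summands, and invariance turns them into
  \<open>B u (nabla z y)\<close> and \<open>- B u (nabla y z)\<close>. The terms in \<open>v\<close> and \<open>w\<close> cancel by
  the cyclic symmetry.\<close>

lemma tangent_form_cocycle:
  assumes "linear \<psi>"
    and inv: "\<And>x u y. dual_apply (\<psi> (nabla x u)) y = - dual_apply (\<psi> u) (nabla x y)"
    and tf: "torsion_free br nabla"
  shows "tangent_form \<psi> X (tangent_bracket br nabla Y Z)
    + tangent_form \<psi> Y (tangent_bracket br nabla Z X)
    + tangent_form \<psi> Z (tangent_bracket br nabla X Y) = 0"
proof -
  note B = bilinear_dual_apply[OF assms(1)]
  have br: "br x y = nabla x y - nabla y x" for x y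
    using tf by (simp add: torsion_free_def)
  show ?thesis
    by (cases X; cases Y; cases Z)
      (simp add: br inv bilinear_lsub[OF B] bilinear_rsub[OF B])
qed

lemma tangent_form_parallel:
  assumes inv: "\<And>x u y. dual_apply (\<psi> (nabla x u)) y = - dual_apply (\<psi> u) (nabla x y)"
  shows "parallel_form (tangent_connection nabla) (tangent_form \<psi>)"
  unfolding parallel_form_def by (auto simp: inv)

theorem proposition4p6:
  fixes br nabla :: "'a::real_vector \<Rightarrow> 'a \<Rightarrow> 'a" and \<psi> :: "'a \<Rightarrow> 'a dual"
  assumes "lie_algebra br"
    and "connection nabla" and "flat br nabla" and "torsion_free br nabla"
    and "module_isomorphism nabla (contragredient nabla) \<psi>"
  shows "symplectic_structure (tangent_bracket br nabla) (tangent_form \<psi>) \<and>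
         parallel_form (tangent_connection nabla) (tangent_form \<psi>)"
proof -
  have \<psi>: "linear \<psi>" "bij \<psi>"
    using assms(5) by (auto simp: module_isomorphism_def)
  note inv = equivariant_pairing_invariant[OF assms(2,5)]
  have "symplectic_structure (tangent_bracket br nabla) (tangent_form \<psi>)"
    unfolding symplectic_structure_def
    by (intro conjI allI impI lie_algebra_tangent_bracket[OF assms(1-3)]
        bilinear_tangent_form[OF \<psi>(1)] tangent_form_skew
        tangent_form_cocycle[OF \<psi>(1) inv assms(4)])
      (rule tangent_form_nondegenerate[OF \<psi>], blast)
  then show ?thesis
    by (simp add: tangent_form_parallel inv)
qed

end
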